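(* A closed convex set $E\subset\mathbb{R}^n$ has bounded convex exhaustion hulls (BCEH) if and only if it is continuous in the sense of Gale and Klee.
   Context: A closed convex set $E\subset\mathbb{R}^n$ has bounded convex exhaustion hulls (BCEH) if for every compact convex set $K\subset\mathbb{R}^n$ the set $h(E,K)=\mathrm{Conv}(E\cup K)\setminus E$ is bounded, where $\mathrm{Conv}$ denotes the convex hull. The support function of $E$ is $\sigma:\{u\in\mathbb{R}^n:|u|=1\}\to\mathbb{R}\cup\{+\infty\}$, $\sigma(u)=\sup\{x\cdot u: x\in E\}$, where $x\cdot u$ is the Euclidean inner product. A closed convex set $E$ is continuous in the sense of Gale and Klee if its support function $\sigma$ is continuous (as a map into $\mathbb{R}\cup\{+\infty\}$ with its usual topology). *)

theory Defs
  imports "HOL-Analysis.Analysis"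
begin

definition exhaustion_hull :: "'a::euclidean_space set \<Rightarrow> 'a set \<Rightarrow> 'a set" where
  "exhaustion_hull E K = convex hull (E \<union> K) - E"

definition bounded_convex_exhaustion_hulls :: "'a::euclidean_space set \<Rightarrow> bool" where
  "bounded_convex_exhaustion_hulls E \<longleftrightarrow>
     (\<forall>K. compact K \<and> convex K \<longrightarrow> bounded (exhaustion_hull E K))"

(* For nonempty E the values lie in the reals together with plus infinity, whose
   usual topology is the subspace topology from ereal.  By convention the
   supremum over the empty set is minus infinity. *)
definition support_function :: "'a::euclidean_space set \<Rightarrow> 'a \<Rightarrow> ereal" where
  "support_function E u = (SUP x\<in>E. ereal (x \<bullet> u))"

definition gale_klee_continuous :: "'a::euclidean_space set \<Rightarrow> bool" where
  "gale_klee_continuous E \<longleftrightarrow> continuous_on {u. norm u = 1} (support_function E)"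

end

theory Submission
  imports Defs
begin

text \<open>
  Write \<open>\<sigma>\<close> for the support function of \<open>E\<close>.  Being a supremum of continuous functions, \<open>\<sigma>\<close> is
  always lower semicontinuous, so continuity can only fail from above: at a unit vector \<open>u\<close> with
  \<open>\<sigma> u < c\<close> that is a limit of unit vectors \<open>v\<close> with \<open>\<sigma> v > c\<close>.  The proof identifies this failure with
  unboundedness of an exhaustion hull.

  If some \<open>v\<close> very close to \<open>u\<close> has a point \<open>e \<in> E\<close> with \<open>e \<bullet> v > c\<close>, then \<open>e\<close> is far away, while
  \<open>e \<bullet> u\<close> is at least \<open>c\<close> up to a small multiple of \<open>norm e\<close>.  The segment from the single point
  \<open>c *\<^sub>R u\<close> to \<open>e\<close> therefore leaves any prescribed ball before its height over \<open>u\<close> drops to \<open>\<sigma> u\<close>, so it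
  produces distant points of the exhaustion hull of \<open>E\<close> and \<open>{c *\<^sub>R u}\<close>
  (\<open>bounded_exhaustion_hull_imp_support_bound_stable\<close>).

  Conversely, let \<open>\<sigma>\<close> be continuous and \<open>K\<close> lie in the ball of radius \<open>M\<close>.  A point \<open>z\<close> of the
  exhaustion hull is separated from \<open>E\<close> in a unit direction \<open>w\<close>, and necessarily \<open>\<sigma> w \<le> M\<close>, since
  otherwise \<open>E \<union> K\<close> and hence \<open>z\<close> would lie on the same side.  Compactness of the sphere makes the
  bound \<open>\<sigma> \<le> M + 1\<close> persist in all directions uniformly close to such \<open>w\<close>
  (\<open>continuous_support_function_uniform_bound\<close>).  Tilting \<open>w\<close> slightly towards \<open>z\<close> keeps the inner
  product with \<open>z\<close> bounded above, but increases it by a fixed multiple of \<open>norm z\<close>; as it was bounded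
  below at \<open>w\<close>, this bounds \<open>norm z\<close> (\<open>exhaustion_hull_norm_bound\<close>).
\<close>

lemma support_function_le_iff:
  "support_function E u \<le> ereal c \<longleftrightarrow> (\<forall>x\<in>E. x \<bullet> u \<le> c)"
  by (simp add: support_function_def SUP_le_iff)

lemma less_support_function_iff:
  "a < support_function E u \<longleftrightarrow> (\<exists>x\<in>E. a < ereal (x \<bullet> u))"
  by (simp add: support_function_def less_SUP_iff)

lemma convex_hull_inner_le:
  assumes "z \<in> convex hull S" and "\<And>x. x \<in> S \<Longrightarrow> x \<bullet> v \<le> c"
  shows "z \<bullet> v \<le> c"
proof -
  have "convex hull S \<subseteq> {x. v \<bullet> x \<le> c}"
    using assms(2) by (intro hull_minimal convex_halfspace_le) (auto simp: inner_commute)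
  with assms(1) show ?thesis by (auto simp: inner_commute)
qed

text \<open>
  The distance \<open>(c - s) / R\<close> is chosen so that changing the direction by less than this alters the
  inner product with a vector of norm at most \<open>R\<close> by less than \<open>c - s\<close>.
\<close>

lemma far_point_in_exhaustion_hull:
  fixes E :: "'a::euclidean_space set"
  assumes u: "norm u = 1" and E: "\<And>x. x \<in> E \<Longrightarrow> x \<bullet> u \<le> s"
    and R: "0 < R" and v: "norm (v - u) < (c - s) / R"
    and e: "e \<in> E" "c < e \<bullet> v"
  obtains z where "z \<in> exhaustion_hull E {c *\<^sub>R u}" "R - \<bar>c\<bar> \<le> norm z"
proof -
  let ?d = "norm (v - u)"
  have Rd: "R * ?d < c - s"
    using v R by (simp add: field_simps)
  have "e \<bullet> v - e \<bullet> u \<le> norm e * ?d"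
    by (metis inner_diff_right norm_cauchy_schwarz)
  then have eu: "e \<bullet> u \<ge> c - norm e * ?d"
    using e by linarith
  have Re: "R < norm e"
  proof (rule ccontr)
    assume "\<not> R < norm e"
    then have "norm e * ?d \<le> R * ?d"
      by (intro mult_right_mono) auto
    then show False
      using eu Rd E[OF e(1)] by linarith
  qed
  define t where "t = R / norm e"
  have t: "0 \<le> t" "t \<le> 1" "t * norm e = R"
    using Re R by (auto simp: t_def divide_le_eq)
  define z where "z = (1 - t) *\<^sub>R (c *\<^sub>R u) + t *\<^sub>R e"
  have "z \<in> convex hull (E \<union> {c *\<^sub>R u})"
    unfolding z_def using t e by (intro convexD[OF convex_convex_hull]) (auto intro: hull_inc)
  moreover have "z \<notin> E"
  proof -
    have "z \<bullet> u = (1 - t) * c + t * (e \<bullet> u)"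
      using u by (simp add: z_def inner_add_left dot_square_norm)
    also have "\<dots> \<ge> (1 - t) * c + t * (c - norm e * ?d)"
      using eu t by (intro add_left_mono mult_left_mono) auto
    also have "(1 - t) * c + t * (c - norm e * ?d) = c - R * ?d"
      using t(3) by (simp add: algebra_simps flip: mult.assoc)
    finally show ?thesis
      using E[of z] Rd by linarith
  qed
  moreover have "R - \<bar>c\<bar> \<le> norm z"
  proof -
    have "R = norm (t *\<^sub>R e)"
      using t by simp
    also have "\<dots> = norm (z - (1 - t) *\<^sub>R (c *\<^sub>R u))"
      by (simp add: z_def)
    also have "\<dots> \<le> norm z + norm ((1 - t) *\<^sub>R (c *\<^sub>R u))"
      by (rule norm_triangle_ineq4)
    also have "norm ((1 - t) *\<^sub>R (c *\<^sub>R u)) = (1 - t) * \<bar>c\<bar>"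
      using u t by (simp add: abs_mult)
    also have "\<dots> \<le> \<bar>c\<bar>"
      using t by (simp add: mult_left_le_one_le)
    finally show ?thesis by simp
  qed
  ultimately show thesis
    using that unfolding exhaustion_hull_def by blast
qed

text \<open>
  Upper semicontinuity of the support function at \<open>u\<close>, stated with real bounds so that it covers the
  value minus infinity without a case distinction.
\<close>

lemma bounded_exhaustion_hull_imp_support_bound_stable:
  fixes E :: "'a::euclidean_space set"
  assumes bdd: "bounded (exhaustion_hull E {c *\<^sub>R u})" and u: "norm u = 1"
    and E: "\<And>x. x \<in> E \<Longrightarrow> x \<bullet> u \<le> s" and sc: "s < c"
  obtains d where "0 < d" "\<And>v x. \<lbrakk>norm (v - u) < d; x \<in> E\<rbrakk> \<Longrightarrow> x \<bullet> v \<le> c"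
proof -
  obtain B where B: "0 < B" "\<And>z. z \<in> exhaustion_hull E {c *\<^sub>R u} \<Longrightarrow> norm z \<le> B"
    using bdd unfolding bounded_pos by auto
  define R where "R = B + \<bar>c\<bar> + 1"
  have R: "0 < R"
    using B by (simp add: R_def)
  show thesis
  proof (rule that)
    show "0 < (c - s) / R"
      using sc R by simp
    fix v x
    assume v: "norm (v - u) < (c - s) / R" and x: "x \<in> E"
    show "x \<bullet> v \<le> c"
    proof (rule ccontr)
      assume "\<not> x \<bullet> v \<le> c"
      then obtain z where "z \<in> exhaustion_hull E {c *\<^sub>R u}" "R - \<bar>c\<bar> \<le> norm z"
        using far_point_in_exhaustion_hull[OF u E R v x] by auto
      then show False
        using B(2)[of z] by (simp add: R_def)
    qed
  qed
qed

lemma bounded_convex_exhaustion_hulls_imp_gale_klee_continuous: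
  fixes E :: "'a::euclidean_space set"
  assumes "bounded_convex_exhaustion_hulls E"
  shows "gale_klee_continuous E"
  unfolding gale_klee_continuous_def continuous_on_def
proof (intro ballI order_tendstoI)
  fix u :: 'a and a :: ereal
  assume "a < support_function E u"
  then obtain x where x: "x \<in> E" "a < ereal (x \<bullet> u)"
    by (auto simp: less_support_function_iff)
  have "((\<lambda>v. ereal (x \<bullet> v)) \<longlongrightarrow> ereal (x \<bullet> u)) (at u within {u. norm u = 1})"
    by (intro tendsto_intros)
  then have "\<forall>\<^sub>F v in at u within {u. norm u = 1}. a < ereal (x \<bullet> v)"
    using x(2) by (rule order_tendstoD)
  then show "\<forall>\<^sub>F v in at u within {u. norm u = 1}. a < support_function E v"
    by eventually_elim (use x(1) in \<open>auto simp: less_support_function_iff\<close>)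
next
  fix u :: 'a and a :: ereal
  assume "u \<in> {u. norm u = 1}" and a: "support_function E u < a"
  then have u: "norm u = 1" by simp
  obtain c where c: "support_function E u < ereal c" "ereal c < a"
    using ereal_dense2[OF a] by blast
  obtain s where s: "support_function E u < ereal s" "ereal s < ereal c"
    using ereal_dense2[OF c(1)] by blast
  have E: "x \<bullet> u \<le> s" if "x \<in> E" for x
    using less_imp_le[OF s(1)] that unfolding support_function_le_iff by blast
  have "bounded (exhaustion_hull E {c *\<^sub>R u})"
    using assms unfolding bounded_convex_exhaustion_hulls_def by simp
  then obtain d where d: "0 < d" "\<And>v x. \<lbrakk>norm (v - u) < d; x \<in> E\<rbrakk> \<Longrightarrow> x \<bullet> v \<le> c"
    using bounded_exhaustion_hull_imp_support_bound_stable[OF _ u E] s(2) by auto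
  have "support_function E v < a" if "dist v u < d" for v
  proof -
    have "support_function E v \<le> ereal c"
      using d(2) that unfolding support_function_le_iff dist_norm by blast
    then show ?thesis
      using c(2) by (rule le_less_trans)
  qed
  then show "\<forall>\<^sub>F v in at u within {u. norm u = 1}. support_function E v < a"
    using d(1) unfolding eventually_at by blast
qed

text \<open>
  In the sphere the sublevel set \<open>{\<sigma> \<le> M}\<close> and the superlevel set \<open>{\<sigma> \<ge> M + 1}\<close> are disjoint and
  compact, hence a positive distance apart.
\<close>

lemma continuous_support_function_uniform_bound:
  fixes E :: "'a::euclidean_space set"
  assumes "gale_klee_continuous E"
  obtains d where "0 < d"
    "\<And>w v. \<lbrakk>norm w = 1; norm v = 1; support_function E w \<le> ereal M; norm (w - v) < d\<rbrakk>
        \<Longrightarrow> support_function E v \<le> ereal (M + 1)"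
proof -
  let ?S = "{u::'a. norm u = 1}"
  let ?A = "?S \<inter> support_function E -` {..ereal M}"
  let ?B = "?S \<inter> support_function E -` {ereal (M + 1)..}"
  have S: "?S = sphere 0 1"
    by (auto simp: sphere_def)
  have cont: "continuous_on ?S (support_function E)"
    using assms by (simp add: gale_klee_continuous_def)
  have closedS: "closed ?S"
    unfolding S by simp
  have A: "closed ?A"
    by (rule continuous_closed_preimage[OF cont closedS]) simp
  have "compact ?A"
    using A bounded_subset[OF bounded_sphere[of 0 1]] unfolding compact_eq_bounded_closed S
    by blast
  moreover have "closed ?B"
    by (rule continuous_closed_preimage[OF cont closedS]) simp
  moreover have "?A \<inter> ?B = {}"
  proof -
    have False if "a \<le> ereal M" "ereal (M + 1) \<le> a" for a
      using order_trans[OF that(2,1)] by simp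
    then show ?thesis by blast
  qed
  ultimately obtain d where d: "0 < d" "\<forall>w\<in>?A. \<forall>v\<in>?B. d \<le> dist w v"
    using separate_compact_closed by metis
  show thesis
  proof (rule that[OF d(1)])
    fix w v :: 'a
    assume *: "norm w = 1" "norm v = 1" "support_function E w \<le> ereal M" "norm (w - v) < d"
    then have "w \<in> ?A" "\<not> d \<le> dist w v"
      by (auto simp: dist_norm)
    then have "v \<notin> ?B"
      using d(2) by blast
    then show "support_function E v \<le> ereal (M + 1)"
      using *(2) by (simp add: not_le less_imp_le)
  qed
qed

lemma norm_normalize_diff_le:
  fixes w v :: "'a::real_normed_vector"
  assumes "norm w = 1"
  shows "norm (w - sgn v) \<le> 2 * norm (w - v)"
proof (cases "v = 0")
  case True
  then show ?thesis using assms by simp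
next
  case False
  have "v - sgn v = (norm v - 1) *\<^sub>R sgn v"
    using False by (simp add: sgn_div_norm algebra_simps)
  then have "norm (v - sgn v) = \<bar>norm v - norm w\<bar>"
    using False assms by (simp add: norm_sgn)
  also have "\<dots> \<le> norm (w - v)"
    by (metis norm_minus_commute norm_triangle_ineq3)
  finally have "norm (v - sgn v) \<le> norm (w - v)" .
  then show ?thesis
    using norm_triangle_ineq[of "w - v" "v - sgn v"] by simp
qed

lemma exhaustion_hull_separating_direction:
  fixes E :: "'a::euclidean_space set"
  assumes E: "closed E" "convex E" "E \<noteq> {}" and z: "z \<in> exhaustion_hull E K"
    and K: "K \<subseteq> cball 0 M"
  obtains w where "norm w = 1" "support_function E w \<le> ereal M" "\<And>x. x \<in> E \<Longrightarrow> x \<bullet> w \<le> z \<bullet> w"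
proof -
  have zE: "z \<notin> E" and zh: "z \<in> convex hull (E \<union> K)"
    using z by (auto simp: exhaustion_hull_def)
  obtain a b where ab: "a \<bullet> z < b" "\<And>x. x \<in> E \<Longrightarrow> b < a \<bullet> x"
    using separating_hyperplane_closed_point[OF E(2,1) zE] by blast
  have a0: "a \<noteq> 0"
    using ab E(3) by fastforce
  define w where "w = sgn (- a)"
  define r where "r = - b / norm a"
  have w: "norm w = 1"
    using a0 by (simp add: w_def norm_sgn)
  have w_inner: "x \<bullet> w = - (a \<bullet> x) / norm a" for x
    by (simp add: w_def sgn_div_norm inner_commute field_simps)
  have zr: "r < z \<bullet> w"
    using ab(1) a0 by (simp add: w_inner r_def divide_strict_right_mono)
  have Er: "x \<bullet> w \<le> r" if "x \<in> E" for x
    using ab(2)[OF that] a0 by (simp add: w_inner r_def divide_right_mono)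
  have "r \<le> M"
  proof (rule ccontr)
    assume "\<not> r \<le> M"
    have "x \<bullet> w \<le> r" if "x \<in> K" for x
    proof -
      have "x \<bullet> w \<le> norm x"
        using norm_cauchy_schwarz[of x w] w by simp
      also have "\<dots> \<le> M"
        using K that by auto
      finally show ?thesis
        using \<open>\<not> r \<le> M\<close> by simp
    qed
    then have "z \<bullet> w \<le> r"
      using Er by (intro convex_hull_inner_le[OF zh]) auto
    with zr show False by simp
  qed
  show thesis
  proof (rule that[OF w])
    show "support_function E w \<le> ereal M"
      using Er \<open>r \<le> M\<close> by (fastforce simp: support_function_le_iff)
    show "x \<bullet> w \<le> z \<bullet> w" if "x \<in> E" for x
      using Er[OF that] zr by simp
  qed
qed

text \<open>
  For the tilted direction \<open>v = w + \<eta> *\<^sub>R sgn z\<close>, the inner product \<open>z \<bullet> v\<close> exceeds \<open>z \<bullet> w\<close> by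
  \<open>\<eta> * norm z\<close>.  The first is bounded above because \<open>v\<close>, once normalized, is still within \<open>d\<close> of
  \<open>w\<close>; the second is bounded below because \<open>w\<close> separates \<open>z\<close> from \<open>x0\<close>.
\<close>

lemma exhaustion_hull_norm_bound:
  fixes E :: "'a::euclidean_space set"
  assumes E: "closed E" "convex E" and x0: "x0 \<in> E"
    and K: "K \<subseteq> cball 0 M" and M: "0 \<le> M"
    and d: "0 < d" "\<And>w v. \<lbrakk>norm w = 1; norm v = 1; support_function E w \<le> ereal M; norm (w - v) < d\<rbrakk>
        \<Longrightarrow> support_function E v \<le> ereal (M + 1)"
    and \<eta>: "0 < \<eta>" "\<eta> < 1" "2 * \<eta> < d" and z: "z \<in> exhaustion_hull E K"
  shows "norm z \<le> (2 * (M + 1) + norm x0) / \<eta>"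
proof -
  have zh: "z \<in> convex hull (E \<union> K)"
    using z by (auto simp: exhaustion_hull_def)
  have "E \<noteq> {}"
    using x0 by auto
  then obtain w where w: "norm w = 1" "support_function E w \<le> ereal M" "\<And>x. x \<in> E \<Longrightarrow> x \<bullet> w \<le> z \<bullet> w"
    using exhaustion_hull_separating_direction[OF E _ z K] by blast
  define v where "v = w + \<eta> *\<^sub>R sgn z"
  have wv: "norm (w - v) \<le> \<eta>"
    using \<eta> by (simp add: v_def norm_sgn)
  have v0: "v \<noteq> 0"
    using wv w(1) \<eta> by auto
  have nv: "norm v \<le> 2"
    using norm_triangle_ineq3[of w v] wv w(1) \<eta> by linarith
  have "norm (w - sgn v) < d"
    using norm_normalize_diff_le[OF w(1), of v] wv \<eta> by linarith
  then have "support_function E (sgn v) \<le> ereal (M + 1)"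
    using v0 w by (intro d(2)[of w]) (auto simp: norm_sgn)
  then have "x \<bullet> sgn v \<le> M + 1" if "x \<in> E" for x
    using that by (auto simp: support_function_le_iff)
  moreover have "x \<bullet> sgn v \<le> M + 1" if "x \<in> K" for x
  proof -
    have "x \<bullet> sgn v \<le> norm x"
      using norm_cauchy_schwarz[of x "sgn v"] v0 by (simp add: norm_sgn)
    then show ?thesis
      using K that by fastforce
  qed
  ultimately have "z \<bullet> sgn v \<le> M + 1"
    by (intro convex_hull_inner_le[OF zh]) auto
  then have "norm v * (z \<bullet> sgn v) \<le> 2 * (M + 1)"
    using mult_left_mono[of "z \<bullet> sgn v" "M + 1" "norm v"] mult_right_mono[OF nv, of "M + 1"] M
    by simp
  moreover have "norm v * (z \<bullet> sgn v) = z \<bullet> v"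
    using v0 by (simp add: sgn_div_norm)
  moreover have "z \<bullet> v = z \<bullet> w + \<eta> * norm z"
    by (cases "z = 0") (auto simp: v_def inner_add_right sgn_div_norm dot_square_norm power2_eq_square)
  moreover have "- norm x0 \<le> z \<bullet> w"
    using w(3)[OF x0] norm_cauchy_schwarz[of "- x0" w] w(1) by simp
  ultimately have "\<eta> * norm z \<le> 2 * (M + 1) + norm x0"
    by linarith
  then show ?thesis
    using \<eta> by (simp add: field_simps)
qed

lemma gale_klee_continuous_imp_bounded_convex_exhaustion_hulls:
  fixes E :: "'a::euclidean_space set"
  assumes E: "closed E" "convex E" and cont: "gale_klee_continuous E"
  shows "bounded_convex_exhaustion_hulls E"
  unfolding bounded_convex_exhaustion_hulls_def
proof (intro allI impI)
  fix K :: "'a set"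
  assume K: "compact K \<and> convex K"
  show "bounded (exhaustion_hull E K)"
  proof (cases "E = {}")
    case True
    then show ?thesis
      using K by (simp add: exhaustion_hull_def hull_same compact_imp_bounded)
  next
    case False
    then obtain x0 where x0: "x0 \<in> E" by auto
    obtain M where M: "0 < M" "K \<subseteq> cball 0 M"
      using compact_imp_bounded[of K] K unfolding bounded_pos subset_iff mem_cball_0 by blast
    obtain d where d: "0 < d"
      "\<And>w v. \<lbrakk>norm w = 1; norm v = 1; support_function E w \<le> ereal M; norm (w - v) < d\<rbrakk>
        \<Longrightarrow> support_function E v \<le> ereal (M + 1)"
      using continuous_support_function_uniform_bound[OF cont, of M] by blast
    define \<eta> where "\<eta> = min (1/2) (d/3)"
    have \<eta>: "0 < \<eta>" "\<eta> < 1" "2 * \<eta> < d"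
      using d(1) by (auto simp: \<eta>_def min_def)
    have "norm z \<le> (2 * (M + 1) + norm x0) / \<eta>" if "z \<in> exhaustion_hull E K" for z
      using exhaustion_hull_norm_bound[OF E x0 M(2) less_imp_le[OF M(1)] d \<eta> that] .
    then show ?thesis
      unfolding bounded_iff by blast
  qed
qed

theorem proposition3p3:
  fixes E :: "(real ^ 'n) set"
  assumes "closed E" and "convex E"
  shows "bounded_convex_exhaustion_hulls E \<longleftrightarrow> gale_klee_continuous E"
  using bounded_convex_exhaustion_hulls_imp_gale_klee_continuous
    gale_klee_continuous_imp_bounded_convex_exhaustion_hulls[OF assms] by blast

end
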